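(* Let $G=(V,E,w)$ be a weighted undirected graph and let $G[V']$, $V'\subseteq V$, be an induced subgraph with $\partial_G(V')=\{u,v\}$. Let $w_1$ denote the edge weight function of $G[V']$. Let $p'$ be a best Max $k$-Cut solution for $G[V']$ subject to the constraint that $u$ and $v$ have the same colour (i.e. a $k$-partition of $V'$ maximizing $w_1(\cdot)$ among those with equal colours on $u$ and $v$), and let $p''$ be a best Max $k$-Cut solution for $G[V']$ in which $u$ and $v$ have different colours. Then deleting all vertices in $V'\setminus\{u,v\}$ from $G$ and setting the weight of the edge $\{u,v\}$ to $w_1(p'')-w_1(p')$ (the edge being inserted if it is not present) is an optimality-preserving data reduction for Max $k$-Cut.
   Context: A weighted graph $G=(V,E,w)$ is an undirected graph with vertex set $V$, edge set $E\subseteq\binom{V}{2}$ and edge weights $w:E\to\mathbb{R}$ (possibly negative). $G[V']$ is the subgraph induced by $V'$, with the inherited edge weights. The boundary of $V'\subseteq V$ is $\partial_G(V')=\{x\in V' : \exists y\in V\setminus V',\ \{x,y\}\in E\}$. A $k$-partition of a set $M$ is a function $p:M\to\{1,\dots,k\}$; $p(x)$ is called the colour of $x$. The weight $w(p)$ of a $k$-partition $p$ of the vertices of a weighted graph is the sum of the weights of all edges whose endpoints have different colours. Max $k$-Cut asks for a $k$-partition of the vertices of maximum weight; such a $k$-partition is an optimum solution. A data transformation for Max $k$-Cut transforms a weighted graph $G=(V,E,w)$ into a weighted graph $H=(V_H,E_H,w_H)$ and provides a reconstruction algorithm that maps any $k$-partition of $V_H$ to a $k$-partition of $V$. It is called a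 data reduction iff either $|V_H|<|V|$, or $|V_H|=|V|$ and $|E_H|<|E|$. It is optimality-preserving iff the reconstruction algorithm maps every optimum Max $k$-Cut solution for $H$ to an optimum Max $k$-Cut solution for $G$.
   Formalization: If V' = {u,v}, no vertex is deleted and the number of edges does not drop, so the strict size decrease required of a data reduction fails; it is claimed only for V' ≠ {u,v}, while the optimality-preserving transformation is proved in all cases. *)

theory Defs
  imports Complex_Main "HOL-Library.FuncSet" "HOL-Library.Ramsey"
    "HOL-Combinatorics.Transposition"
begin

text \<open>Only the values of \<open>weight\<close> on \<open>edges\<close> are meaningful; all notions below
  depend on those values only.\<close>

record 'a wgraph =
  verts :: "'a set"
  edges :: "'a set set"
  weight :: "'a set \<Rightarrow> real"

definition weighted_graph :: "'a wgraph \<Rightarrow> bool" where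
  "weighted_graph G \<longleftrightarrow> finite (verts G) \<and> edges G \<subseteq> nsets (verts G) 2"

definition induced_subgraph :: "'a wgraph \<Rightarrow> 'a set \<Rightarrow> 'a wgraph" where
  "induced_subgraph G W =
    \<lparr>verts = W, edges = {e \<in> edges G. e \<subseteq> W}, weight = weight G\<rparr>"

definition boundary :: "'a wgraph \<Rightarrow> 'a set \<Rightarrow> 'a set" where
  "boundary G W = {x \<in> W. \<exists>y \<in> verts G - W. {x, y} \<in> edges G}"

text \<open>Partitions are extensional functions, so that they are determined by their values on
  the set being partitioned.\<close>

definition k_partitions :: "nat \<Rightarrow> 'a set \<Rightarrow> ('a \<Rightarrow> nat) set" where
  "k_partitions k M = (M \<rightarrow>\<^sub>E {1..k})"

definition cut_weight :: "'a wgraph \<Rightarrow> ('a \<Rightarrow> nat) \<Rightarrow> real" where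
  "cut_weight G p = (\<Sum>e | e \<in> edges G \<and> (\<exists>x\<in>e. \<exists>y\<in>e. p x \<noteq> p y). weight G e)"

definition max_k_cut :: "nat \<Rightarrow> 'a wgraph \<Rightarrow> ('a \<Rightarrow> nat) \<Rightarrow> bool" where
  "max_k_cut k G p \<longleftrightarrow> is_arg_max (cut_weight G) (\<lambda>q. q \<in> k_partitions k (verts G)) p"

definition data_transformation ::
  "nat \<Rightarrow> 'a wgraph \<Rightarrow> 'a wgraph \<Rightarrow> (('a \<Rightarrow> nat) \<Rightarrow> 'a \<Rightarrow> nat) \<Rightarrow> bool" where
  "data_transformation k G H r \<longleftrightarrow>
    weighted_graph G \<and> weighted_graph H \<and>
    (\<forall>p \<in> k_partitions k (verts H). r p \<in> k_partitions k (verts G))"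

definition data_reduction ::
  "nat \<Rightarrow> 'a wgraph \<Rightarrow> 'a wgraph \<Rightarrow> (('a \<Rightarrow> nat) \<Rightarrow> 'a \<Rightarrow> nat) \<Rightarrow> bool" where
  "data_reduction k G H r \<longleftrightarrow>
    data_transformation k G H r \<and>
    (card (verts H) < card (verts G) \<or>
     card (verts H) = card (verts G) \<and> card (edges H) < card (edges G))"

definition optimality_preserving ::
  "nat \<Rightarrow> 'a wgraph \<Rightarrow> 'a wgraph \<Rightarrow> (('a \<Rightarrow> nat) \<Rightarrow> 'a \<Rightarrow> nat) \<Rightarrow> bool" where
  "optimality_preserving k G H r \<longleftrightarrow> (\<forall>p. max_k_cut k H p \<longrightarrow> max_k_cut k G (r p))"

definition delete_verts :: "'a wgraph \<Rightarrow> 'a set \<Rightarrow> 'a wgraph" where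
  "delete_verts G W = induced_subgraph G (verts G - W)"

definition set_edge :: "'a wgraph \<Rightarrow> 'a set \<Rightarrow> real \<Rightarrow> 'a wgraph" where
  "set_edge G e c = G\<lparr>edges := insert e (edges G), weight := (weight G)(e := c)\<rparr>"

definition reduced_graph ::
  "'a wgraph \<Rightarrow> 'a set \<Rightarrow> 'a \<Rightarrow> 'a \<Rightarrow> ('a \<Rightarrow> nat) \<Rightarrow> ('a \<Rightarrow> nat) \<Rightarrow> 'a wgraph" where
  "reduced_graph G W u v p1 p2 =
    set_edge (delete_verts G (W - {u, v})) {u, v}
      (cut_weight (induced_subgraph G W) p2 - cut_weight (induced_subgraph G W) p1)"

text \<open>A permutation of colours sending \<open>a\<close> to \<open>c\<close> and \<open>b\<close> to \<open>d\<close>, provided that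
  \<open>a = b \<longleftrightarrow> c = d\<close>.\<close>

definition recolour :: "nat \<Rightarrow> nat \<Rightarrow> nat \<Rightarrow> nat \<Rightarrow> nat \<Rightarrow> nat" where
  "recolour a b c d = transpose (transpose a c b) d \<circ> transpose a c"

text \<open>The reconstruction algorithm extends a partition of the reduced graph to \<open>W\<close> by
  whichever of \<open>p1\<close> (equal colours on \<open>u\<close> and \<open>v\<close>) and \<open>p2\<close> (different colours) fits, after
  renaming colours to match on \<open>u\<close> and \<open>v\<close>. It is given explicitly because mere existence of
  an optimality-preserving function is trivial: a constant function would do.\<close>

definition reconstruct ::
  "'a wgraph \<Rightarrow> 'a set \<Rightarrow> 'a \<Rightarrow> 'a \<Rightarrow> ('a \<Rightarrow> nat) \<Rightarrow> ('a \<Rightarrow> nat) \<Rightarrow> ('a \<Rightarrow> nat) \<Rightarrow> 'a \<Rightarrow> nat"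
  where
  "reconstruct G W u v p1 p2 p =
    (let q = (if p u = p v then p1 else p2)
     in (\<lambda>x\<in>verts G. if x \<in> W then recolour (q u) (q v) (p u) (p v) (q x) else p x))"

end

theory Submission
  imports Defs
begin

text \<open>Every edge of \<open>G\<close> lies inside \<open>V'\<close> or meets \<open>V'\<close> only in \<open>u\<close> and \<open>v\<close>, so a cut of \<open>G\<close>
  splits into a cut of \<open>G[V']\<close> and a cut of the remaining edges. Given the colours of \<open>u\<close> and
  \<open>v\<close>, the first part weighs at most \<open>w\<^sub>1(p')\<close> or \<open>w\<^sub>1(p'')\<close>, and the bound is attained by a
  recoloured \<open>p'\<close> or \<open>p''\<close>, because cut weights are invariant under injective renamings of
  colours. Up to the constant \<open>w\<^sub>1(p')\<close>, the weighted edge \<open>{u, v}\<close> of the reduced graph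
  contributes exactly this optimum.\<close>

text \<open>Whether an edge is cut depends only on which of its endpoints share a colour. The
  hypothesis therefore covers both partitions agreeing on the endpoints and injective renamings of
  colours.\<close>

lemma cut_weight_cong:
  assumes "\<And>e x y. e \<in> edges G \<Longrightarrow> x \<in> e \<Longrightarrow> y \<in> e \<Longrightarrow> p x = p y \<longleftrightarrow> q x = q y"
  shows "cut_weight G p = cut_weight G q"
proof -
  have "{e \<in> edges G. \<exists>x\<in>e. \<exists>y\<in>e. p x \<noteq> p y} = {e \<in> edges G. \<exists>x\<in>e. \<exists>y\<in>e. q x \<noteq> q y}"
    using assms by blast
  then show ?thesis
    unfolding cut_weight_def by (rule arg_cong)
qed

lemma weighted_graph_finite_edges: "weighted_graph G \<Longrightarrow> finite (edges G)"
  unfolding weighted_graph_def by (meson finite_imp_finite_nsets finite_subset)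

lemma cut_weight_split:
  assumes "finite (edges G)"
  shows "cut_weight G p = cut_weight (G\<lparr>edges := {e \<in> edges G. P e}\<rparr>) p
    + cut_weight (G\<lparr>edges := {e \<in> edges G. \<not> P e}\<rparr>) p"
proof -
  let ?c = "\<lambda>e. \<exists>x\<in>e. \<exists>y\<in>e. p x \<noteq> p y"
  have "{e \<in> edges G. ?c e} = {e \<in> {e \<in> edges G. P e}. ?c e} \<union> {e \<in> {e \<in> edges G. \<not> P e}. ?c e}"
    by blast
  then show ?thesis
    unfolding cut_weight_def
    using assms by (simp, subst sum.union_disjoint) auto
qed

lemma cut_weight_induced_subgraph:
  "cut_weight (induced_subgraph G W) p = cut_weight (G\<lparr>edges := {e \<in> edges G. e \<subseteq> W}\<rparr>) p"
  by (simp add: cut_weight_def induced_subgraph_def)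

text \<open>Such an edge has one endpoint outside \<open>W\<close>, so its other endpoint, if in
  \<open>W\<close>, is a boundary vertex by definition.\<close>

lemma edge_outside_boundary:
  assumes "weighted_graph G" "e \<in> edges G" "\<not> e \<subseteq> W"
  shows "e \<subseteq> verts G - (W - boundary G W)"
proof
  fix x assume x: "x \<in> e"
  have e: "e \<subseteq> verts G" "card e = 2"
    using assms(1,2) by (auto simp: weighted_graph_def nsets_def)
  have "x \<in> boundary G W" if "x \<in> W"
  proof -
    obtain y where y: "y \<in> e" "y \<notin> W"
      using assms(3) by blast
    then have "e = {x, y}"
      using e(2) x that by (auto simp: card_2_iff)
    then show ?thesis
      using y e(1) assms(2) that by (auto simp: boundary_def)
  qed
  then show "x \<in> verts G - (W - boundary G W)"
    using x e(1) by blast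
qed

lemma verts_reduced_graph: "verts (reduced_graph G W u v p1 p2) = verts G - (W - {u, v})"
  by (simp add: reduced_graph_def set_edge_def delete_verts_def induced_subgraph_def)

text \<open>The only edge inside \<open>W\<close> that can survive the deletion is
  \<open>{u, v}\<close> itself, and the insertion absorbs it.\<close>

lemma edges_reduced_graph:
  assumes "weighted_graph G" "boundary G W = {u, v}"
  shows "edges (reduced_graph G W u v p1 p2) = insert {u, v} {e \<in> edges G. \<not> e \<subseteq> W}"
proof -
  have "e = {u, v}"
    if "e \<in> edges G" "e \<subseteq> verts G - (W - {u, v})" "e \<subseteq> W" for e
  proof -
    have "e \<subseteq> {u, v}" "card e = 2"
      using that assms(1) by (auto simp: weighted_graph_def nsets_def)
    then show ?thesis
      by (auto simp: card_2_iff)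
  qed
  then show ?thesis
    using edge_outside_boundary[OF assms(1), of _ W] assms
    by (auto simp: reduced_graph_def set_edge_def delete_verts_def induced_subgraph_def
        weighted_graph_def nsets_def)
qed

lemma weighted_graph_reduced_graph:
  assumes "weighted_graph G" "W \<subseteq> verts G" "boundary G W = {u, v}" "u \<noteq> v"
  shows "weighted_graph (reduced_graph G W u v p1 p2)"
proof -
  have "{u, v} \<subseteq> W"
    using assms(3) by (auto simp: boundary_def)
  then have "{u, v} \<in> nsets (verts G - (W - {u, v})) 2"
    using assms(2,4) by (auto simp: nsets_def)
  moreover have "e \<in> nsets (verts G - (W - {u, v})) 2" if "e \<in> edges G" "\<not> e \<subseteq> W" for e
    using edge_outside_boundary[OF assms(1) that] assms(1,3) that(1)
    by (auto simp: weighted_graph_def nsets_def)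
  ultimately show ?thesis
    using assms(1)
    by (auto simp: weighted_graph_def verts_reduced_graph edges_reduced_graph[OF assms(1,3)])
qed

text \<open>If \<open>{u, v}\<close> is already an edge of \<open>G\<close>, its old weight is
  counted within \<open>induced_subgraph G W\<close>, so overwriting it neither loses nor duplicates
  anything.\<close>

lemma cut_weight_reduced_graph:
  assumes "weighted_graph G" "boundary G W = {u, v}"
  shows "cut_weight (reduced_graph G W u v p1 p2) p =
    (if p u = p v then 0
     else cut_weight (induced_subgraph G W) p2 - cut_weight (induced_subgraph G W) p1)
    + cut_weight (G\<lparr>edges := {e \<in> edges G. \<not> e \<subseteq> W}\<rparr>) p"
proof -
  let ?c = "\<lambda>e. \<exists>x\<in>e. \<exists>y\<in>e. p x \<noteq> p y"
  let ?F = "{e \<in> edges G. \<not> e \<subseteq> W \<and> ?c e}"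
  let ?d = "cut_weight (induced_subgraph G W) p2 - cut_weight (induced_subgraph G W) p1"
  have uv: "{u, v} \<subseteq> W"
    using assms(2) by (auto simp: boundary_def)
  have fin: "finite ?F"
    using weighted_graph_finite_edges[OF assms(1)] by simp
  have w: "weight (reduced_graph G W u v p1 p2) = (weight G)({u, v} := ?d)"
    by (simp add: reduced_graph_def set_edge_def delete_verts_def induced_subgraph_def)
  have set: "{e \<in> insert {u, v} {e \<in> edges G. \<not> e \<subseteq> W}. ?c e} =
      (if p u = p v then ?F else insert {u, v} ?F)"
    by auto
  \<comment> \<open>Edges in \<open>?F\<close> leave \<open>W\<close>, so none of them is
    \<open>{u, v}\<close> and the overwritten value is never read.\<close>
  have sumF: "sum ((weight G)({u, v} := ?d)) ?F = sum (weight G) ?F"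
    using uv by (intro sum.cong) auto
  have notin: "{u, v} \<notin> ?F"
    using uv by blast
  have "cut_weight (reduced_graph G W u v p1 p2) p =
      sum ((weight G)({u, v} := ?d)) (if p u = p v then ?F else insert {u, v} ?F)"
    unfolding cut_weight_def[of "reduced_graph G W u v p1 p2"] edges_reduced_graph[OF assms] w set ..
  also have "\<dots> = (if p u = p v then 0 else ?d) + sum (weight G) ?F"
    using sumF sum.insert[OF fin notin, of "(weight G)({u, v} := ?d)"] by (simp del: fun_upd_apply) simp
  also have "sum (weight G) ?F = cut_weight (G\<lparr>edges := {e \<in> edges G. \<not> e \<subseteq> W}\<rparr>) p"
    by (simp add: cut_weight_def)
  finally show ?thesis .
qed

lemma inj_recolour: "inj (recolour a b c d)"
  by (simp add: recolour_def inj_compose)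

text \<open>The first transposition sends \<open>a\<close> to \<open>c\<close>; the second swaps the
  image of \<open>b\<close> with \<open>d\<close>. If \<open>a \<noteq> b\<close>, neither of these
  is \<open>c\<close>; if \<open>a = b\<close>, both are \<open>c\<close> and the swap is
  trivial.\<close>

lemma recolour_fst: "a = b \<longleftrightarrow> c = d \<Longrightarrow> recolour a b c d a = c"
  by (auto simp: recolour_def transpose_def)

lemma recolour_snd: "recolour a b c d b = d"
  by (simp add: recolour_def)

lemma recolour_in: "\<lbrakk>a \<in> S; b \<in> S; c \<in> S; d \<in> S; x \<in> S\<rbrakk> \<Longrightarrow> recolour a b c d x \<in> S"
  by (simp add: recolour_def transpose_def)

theorem theorem11:
  fixes G :: "'a wgraph" and V' :: "'a set" and u v :: 'a and k :: nat
    and p' p'' :: "'a \<Rightarrow> nat"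
  assumes "weighted_graph G"
    and "V' \<subseteq> verts G"
    and "boundary G V' = {u, v}"
    and "is_arg_max (cut_weight (induced_subgraph G V'))
           (\<lambda>q. q \<in> k_partitions k V' \<and> q u = q v) p'"
    and "is_arg_max (cut_weight (induced_subgraph G V'))
           (\<lambda>q. q \<in> k_partitions k V' \<and> q u \<noteq> q v) p''"
  defines "H \<equiv> reduced_graph G V' u v p' p''"
    and "r \<equiv> reconstruct G V' u v p' p''"
  shows "data_transformation k G H r \<and> optimality_preserving k G H r \<and>
         (V' \<noteq> {u, v} \<longrightarrow> data_reduction k G H r)"
proof -
  let ?U = "verts G - (V' - {u, v})"
  let ?A = "cut_weight (induced_subgraph G V')"
  let ?B = "cut_weight (G\<lparr>edges := {e \<in> edges G. \<not> e \<subseteq> V'}\<rparr>)"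
  let ?q = "\<lambda>p. if p u = p v then p' else p''"
  have p': "p' \<in> k_partitions k V'" "p' u = p' v"
    and p'_max: "\<And>q. q \<in> k_partitions k V' \<Longrightarrow> q u = q v \<Longrightarrow> ?A q \<le> ?A p'"
    using assms(4) by (auto simp: is_arg_max_linorder)
  have p'': "p'' \<in> k_partitions k V'" "p'' u \<noteq> p'' v"
    and p''_max: "\<And>q. q \<in> k_partitions k V' \<Longrightarrow> q u \<noteq> q v \<Longrightarrow> ?A q \<le> ?A p''"
    using assms(5) by (auto simp: is_arg_max_linorder)
  \<comment> \<open>That \<open>u\<close> and \<open>v\<close> are distinct follows from
    \<open>p''\<close> colouring them differently.\<close>
  have uv: "u \<in> V'" "v \<in> V'" "u \<noteq> v"
    using assms(3) p''(2) by (auto simp: boundary_def)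
  have vertsH: "verts H = ?U"
    by (simp add: H_def verts_reduced_graph)
  have cutG: "cut_weight G q = ?A q + ?B q" for q
    unfolding cut_weight_induced_subgraph
    by (rule cut_weight_split[OF weighted_graph_finite_edges[OF assms(1)]])
  have cutH: "cut_weight H q = (if q u = q v then 0 else ?A p'' - ?A p') + ?B q" for q
    unfolding H_def by (rule cut_weight_reduced_graph[OF assms(1,3)])
  have B_cong: "?B p = ?B q" if "\<And>x. x \<in> ?U \<Longrightarrow> p x = q x" for p q
  proof (rule cut_weight_cong)
    fix e x y
    assume e: "e \<in> edges (G\<lparr>edges := {e \<in> edges G. \<not> e \<subseteq> V'}\<rparr>)" "x \<in> e" "y \<in> e"
    have "e \<subseteq> ?U"
      using edge_outside_boundary[OF assms(1), of e V'] e(1) unfolding assms(3) by simp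
    then have "x \<in> ?U" "y \<in> ?U"
      using e(2,3) by blast+
    then show "p x = p y \<longleftrightarrow> q x = q y"
      by (simp only: that)
  qed
  have r_in: "r p x = recolour (?q p u) (?q p v) (p u) (p v) (?q p x)" if "x \<in> V'" for p x
    using that assms(2) by (auto simp: r_def reconstruct_def Let_def)
  \<comment> \<open>At \<open>u\<close> and \<open>v\<close> the recolouring restores the colours of
    \<open>p\<close>, since \<open>?q p\<close> is chosen to agree with \<open>p\<close> on whether
    these two colours coincide.\<close>
  have r_U: "r p x = p x" if "x \<in> ?U" for p x
  proof (cases "x \<in> V'")
    case True
    then have "x = u \<or> x = v" using that by blast
    moreover have "?q p u = ?q p v \<longleftrightarrow> p u = p v" using p' p'' by simp
    ultimately show ?thesis
      using r_in[OF True] by (auto simp: recolour_fst recolour_snd)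
  next
    case False
    then show ?thesis using that by (simp add: r_def reconstruct_def Let_def)
  qed
  have r_part: "r p \<in> k_partitions k (verts G)" if "p \<in> k_partitions k (verts H)" for p
  proof -
    have pU: "p x \<in> {1..k}" if "x \<in> ?U" for x
      using \<open>p \<in> _\<close> that unfolding vertsH k_partitions_def by (rule PiE_mem)
    have qV: "?q p x \<in> {1..k}" if "x \<in> V'" for x
      using p'(1) p''(1) that unfolding k_partitions_def by (auto dest: PiE_mem)
    have "r p x \<in> {1..k}" if "x \<in> verts G" for x
    proof (cases "x \<in> V'")
      case True
      have "p u \<in> {1..k}" "p v \<in> {1..k}"
        using pU uv assms(2) by blast+
      then show ?thesis
        unfolding r_in[OF True] using qV[OF uv(1)] qV[OF uv(2)] qV[OF True]
        by (intro recolour_in)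
    next
      case False
      then show ?thesis using that pU[of x] r_U[of x p] by simp
    qed
    moreover have "r p \<in> extensional (verts G)"
      by (simp add: r_def reconstruct_def Let_def)
    ultimately show ?thesis
      by (simp add: k_partitions_def PiE_def)
  qed
  \<comment> \<open>On \<open>V'\<close>, \<open>r p\<close> is an injective recolouring of
    \<open>?q p\<close>, and elsewhere it is \<open>p\<close>. The weight of \<open>{u, v}\<close>
    in \<open>H\<close> is the excess of \<open>?A (?q p)\<close> over \<open>?A p'\<close>.\<close>
  have cut_r: "cut_weight G (r p) = cut_weight H p + ?A p'" for p
  proof -
    have "?A (r p) = ?A (?q p)"
      by (rule cut_weight_cong)
        (auto simp: induced_subgraph_def r_in subset_iff inj_eq[OF inj_recolour])
    moreover have "?B (r p) = ?B p"
      by (intro B_cong r_U)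
    ultimately show ?thesis
      by (simp add: cutG cutH)
  qed
  have cut_le: "cut_weight G q \<le> cut_weight H (restrict q ?U) + ?A p'"
    if q: "q \<in> k_partitions k (verts G)" for q
  proof -
    \<comment> \<open>Maximality of \<open>p'\<close> and \<open>p''\<close> concerns extensional
      functions on \<open>V'\<close>, hence the restriction.\<close>
    have "restrict q V' \<in> k_partitions k V'"
      using q assms(2) by (auto simp: k_partitions_def PiE_iff)
    then have "?A (restrict q V') \<le> ?A (?q q)"
      using p'_max p''_max uv by simp
    moreover have "?A (restrict q V') = ?A q"
      by (rule cut_weight_cong) (auto simp: induced_subgraph_def)
    moreover have "?B (restrict q ?U) = ?B q"
      by (intro B_cong) simp
    moreover have "restrict q ?U u = q u" "restrict q ?U v = q v"
      using uv assms(2) by auto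
    ultimately show ?thesis
      by (simp add: cutG cutH split: if_splits)
  qed
  have trans: "data_transformation k G H r"
    using assms(1) weighted_graph_reduced_graph[OF assms(1,2,3) uv(3)] r_part
    by (simp add: data_transformation_def H_def)
  moreover have "optimality_preserving k G H r"
    unfolding optimality_preserving_def max_k_cut_def is_arg_max_linorder
  proof (intro allI impI conjI)
    fix p assume p: "p \<in> k_partitions k (verts H) \<and>
      (\<forall>q. q \<in> k_partitions k (verts H) \<longrightarrow> cut_weight H q \<le> cut_weight H p)"
    then show "r p \<in> k_partitions k (verts G)" by (simp add: r_part)
    fix q assume q: "q \<in> k_partitions k (verts G)"
    then have "restrict q ?U \<in> k_partitions k (verts H)"
      by (auto simp: k_partitions_def vertsH PiE_iff)
    then have "cut_weight H (restrict q ?U) \<le> cut_weight H p"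
      using p by blast
    \<comment> \<open>Both estimates carry the same constant \<open>?A p'\<close>, so it cancels and
      optimality of \<open>p\<close> in \<open>H\<close> transfers to \<open>r p\<close>.\<close>
    then show "cut_weight G q \<le> cut_weight G (r p)"
      using cut_le[OF q] cut_r[of p] by linarith
  qed
  moreover have "data_reduction k G H r" if "V' \<noteq> {u, v}"
  proof -
    \<comment> \<open>Some vertex of \<open>V'\<close> other than \<open>u\<close> and
      \<open>v\<close> is deleted. For \<open>V' = {u, v}\<close> neither the vertex count nor the
      edge count would drop.\<close>
    have "?U \<subset> verts G"
      using that uv assms(2) by blast
    then have "card (verts H) < card (verts G)"
      using assms(1) by (simp add: vertsH weighted_graph_def psubset_card_mono)
    then show ?thesis
      using trans by (simp add: data_reduction_def)
  qed
  ultimately show ?thesis by blast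
qed

end
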